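(* Let $l\in\mathbb{N}$ and let $A\subseteq\mathbb{N}$ be a piecewise syndetic set. For each $i=1,\dots,l$ let $(x^i_\alpha)_{\alpha}$ be an IP-set. Then for every finite $F\subseteq\mathbb{P}$ there exist $a\in\mathbb{N}$ and a nonempty finite $\beta\subseteq\mathbb{N}$ such that $a+P(x^i_\beta)\in A$ for all $i\in\{1,\dots,l\}$ and all $P\in F$.
   Context: $\mathbb{P}$ denotes the set of polynomials with integer coefficients which vanish at $0$ and map $\mathbb{N}$ into $\mathbb{N}$. An IP-set is a family $(x_\alpha)_{\alpha}$ indexed by the nonempty finite subsets $\alpha$ of $\mathbb{N}$, with $x_\alpha=\sum_{t\in\alpha}x_t$ for some sequence $(x_n)_{n\in\mathbb{N}}$ in $\mathbb{N}$. Piecewise syndetic is the standard notion in $(\mathbb{N},+)$. *)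

theory Defs
  imports "HOL-Computational_Algebra.Polynomial"
begin

text \<open>Throughout, the natural numbers of the source are the positive integers.\<close>

abbreviation Pos :: "nat set" where
  "Pos \<equiv> {1..}"

definition thick :: "nat set \<Rightarrow> bool" where
  "thick B \<longleftrightarrow> (\<forall>H. finite H \<and> H \<noteq> {} \<and> H \<subseteq> Pos \<longrightarrow> (\<exists>x\<in>Pos. \<forall>h\<in>H. h + x \<in> B))"

text \<open>In the semigroup of positive integers under addition, the translate \<open>-t + A\<close> is
  \<open>{n \<in> Pos. t + n \<in> A}\<close>.\<close>

definition piecewise_syndetic :: "nat set \<Rightarrow> bool" where
  "piecewise_syndetic A \<longleftrightarrow>
     (\<exists>G. finite G \<and> G \<noteq> {} \<and> G \<subseteq> Pos \<and> thick (\<Union>t\<in>G. {n \<in> Pos. t + n \<in> A}))"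

text \<open>A family indexed by the nonempty finite subsets of \<open>Pos\<close> is a function on sets whose
  values elsewhere are irrelevant.\<close>

definition IP_set :: "(nat set \<Rightarrow> nat) \<Rightarrow> bool" where
  "IP_set X \<longleftrightarrow>
     (\<exists>s. (\<forall>n\<in>Pos. s n \<in> Pos) \<and>
          (\<forall>\<alpha>. finite \<alpha> \<and> \<alpha> \<noteq> {} \<and> \<alpha> \<subseteq> Pos \<longrightarrow> X \<alpha> = (\<Sum>t\<in>\<alpha>. s t)))"

definition IPoly :: "int poly set" where
  "IPoly = {P. poly P 0 = 0 \<and> (\<forall>n\<in>Pos. poly P (int n) \<in> int ` Pos)}"

end

theory Submission
  imports Defs "HOL-Library.Multiset" "HOL-Library.FuncSet"
begin

text \<open>The partition version is proved by colour focusing with a PET induction, for maps from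
  finite sets to integers that are annihilated by finitely many differences
  \<open>v (\<alpha> \<union> \<beta>) - v \<alpha> - v \<beta>\<close>. A finite system of such maps is covered by cosets
  \<open>s + P\<^sub>d\<close>, where \<open>P\<^sub>d\<close> consists of the maps of degree at most \<open>d\<close> and \<open>s \<in> P\<^sub>d\<^sub>+\<^sub>1\<close>.
  Subtracting a member \<open>v\<^sub>1\<close> of a coset with \<open>d\<close> minimal replaces that coset by finitely many
  cosets with smaller \<open>d\<close>, so the multiset of the numbers \<open>d\<close> decreases. A piecewise syndetic
  set has finitely many translates covering arbitrarily long patterns, and these translates
  are the colours.\<close>

section \<open>Polynomial maps on finite sets of natural numbers\<close>

text \<open>Differences are taken only in directions \<open>\<alpha>\<close> lying entirely below the remaining
  argument; the index \<open>m\<close> records from where on the arguments are drawn.\<close>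

fun set_poly :: "nat \<Rightarrow> nat \<Rightarrow> (nat set \<Rightarrow> int) \<Rightarrow> bool" where
  "set_poly 0 m v \<longleftrightarrow> (\<forall>\<beta>. finite \<beta> \<and> \<beta> \<subseteq> {m..} \<longrightarrow> v \<beta> = 0)"
| "set_poly (Suc d) m v \<longleftrightarrow> v {} = 0 \<and>
     (\<forall>n\<ge>m. \<forall>\<alpha>\<subseteq>{m..<n}. set_poly d n (\<lambda>\<beta>. v (\<alpha> \<union> \<beta>) - v \<alpha> - v \<beta>))"

lemma set_poly_empty: "set_poly d m v \<Longrightarrow> v {} = 0"
  by (cases d) auto

lemma set_poly_mono_start: "set_poly d m v \<Longrightarrow> m \<le> n \<Longrightarrow> set_poly d n v"
proof (cases d)
  case 0
  assume "set_poly d m v" "m \<le> n"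
  then show ?thesis using 0 by (auto dest!: order_trans[of _ "{n..}" "{m..}"])
next
  case (Suc e)
  assume *: "set_poly d m v" "m \<le> n"
  have "\<alpha> \<subseteq> {m..<k}" if "\<alpha> \<subseteq> {n..<k}" for \<alpha> k using that *(2) by fastforce
  then show ?thesis using * Suc by auto
qed

lemma set_poly_zero: "set_poly d m (\<lambda>\<beta>. 0)"
  by (induction d arbitrary: m) auto

lemma set_poly_Suc: "set_poly d m v \<Longrightarrow> set_poly (Suc d) m v"
proof (induction d arbitrary: m v)
  case 0
  have "v (\<alpha> \<union> \<beta>) - v \<alpha> - v \<beta> = 0"
    if "n \<ge> m" "\<alpha> \<subseteq> {m..<n}" "finite \<beta>" "\<beta> \<subseteq> {n..}" for n \<alpha> \<beta>
  proof -
    have "finite \<alpha>" using that(2) finite_subset by blast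
    moreover have "\<alpha> \<subseteq> {m..}" "\<beta> \<subseteq> {m..}" using that by fastforce+
    ultimately have "v \<alpha> = 0" "v \<beta> = 0" "v (\<alpha> \<union> \<beta>) = 0" using 0 that(3) by auto
    then show ?thesis by simp
  qed
  then show ?case using set_poly_empty[OF 0] by simp
next
  case (Suc d)
  have "set_poly (Suc d) n (\<lambda>\<beta>. v (\<alpha> \<union> \<beta>) - v \<alpha> - v \<beta>)"
    if "n \<ge> m" "\<alpha> \<subseteq> {m..<n}" for n \<alpha>
    using Suc.prems that by (intro Suc.IH) simp
  then show ?case using set_poly_empty[OF Suc.prems] set_poly.simps(2) by blast
qed

lemma set_poly_mono_degree: "set_poly d m v \<Longrightarrow> d \<le> e \<Longrightarrow> set_poly e m v"
  by (induction e) (auto simp only: le_Suc_eq set_poly_Suc le_zero_eq)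

lemma set_poly_add:
  "set_poly d m v \<Longrightarrow> set_poly d m w \<Longrightarrow> set_poly d m (\<lambda>\<beta>. v \<beta> + w \<beta>)"
proof (induction d arbitrary: m v w)
  case (Suc d)
  have "set_poly d n (\<lambda>\<beta>. v (\<alpha> \<union> \<beta>) + w (\<alpha> \<union> \<beta>) - (v \<alpha> + w \<alpha>) - (v \<beta> + w \<beta>))"
    if "n \<ge> m" "\<alpha> \<subseteq> {m..<n}" for n \<alpha>
  proof -
    have "set_poly d n (\<lambda>\<beta>. (v (\<alpha> \<union> \<beta>) - v \<alpha> - v \<beta>) + (w (\<alpha> \<union> \<beta>) - w \<alpha> - w \<beta>))"
      using Suc.prems that by (intro Suc.IH) auto
    then show ?thesis by (simp add: algebra_simps)
  qed
  then show ?case using Suc.prems by simp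
qed simp

lemma set_poly_uminus: "set_poly d m v \<Longrightarrow> set_poly d m (\<lambda>\<beta>. - v \<beta>)"
proof (induction d arbitrary: m v)
  case (Suc d)
  have "set_poly d n (\<lambda>\<beta>. - v (\<alpha> \<union> \<beta>) - - v \<alpha> - - v \<beta>)"
    if "n \<ge> m" "\<alpha> \<subseteq> {m..<n}" for n \<alpha>
  proof -
    have "set_poly d n (\<lambda>\<beta>. - (v (\<alpha> \<union> \<beta>) - v \<alpha> - v \<beta>))"
      using Suc.prems that by (intro Suc.IH) auto
    then show ?thesis by (simp add: algebra_simps)
  qed
  then show ?case using Suc.prems by simp
qed simp

lemma set_poly_diff:
  "set_poly d m v \<Longrightarrow> set_poly d m w \<Longrightarrow> set_poly d m (\<lambda>\<beta>. v \<beta> - w \<beta>)"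
  using set_poly_add[OF _ set_poly_uminus] by fastforce

text \<open>Values at infinite sets, or at sets containing numbers below \<open>m\<close>, never
  enter. This permits rewriting by identities that hold only for sets placed above one another, such
  as additivity of sums.\<close>

lemma set_poly_cong:
  assumes "set_poly d m v" "\<And>\<beta>. finite \<beta> \<Longrightarrow> \<beta> \<subseteq> {m..} \<Longrightarrow> v \<beta> = w \<beta>"
  shows "set_poly d m w"
  using assms
proof (induction d arbitrary: m v w)
  case (Suc d)
  have "set_poly d n (\<lambda>\<beta>. w (\<alpha> \<union> \<beta>) - w \<alpha> - w \<beta>)"
    if "n \<ge> m" "\<alpha> \<subseteq> {m..<n}" for n \<alpha>
  proof (rule Suc.IH)
    show "set_poly d n (\<lambda>\<beta>. v (\<alpha> \<union> \<beta>) - v \<alpha> - v \<beta>)" using Suc.prems(1) that by simp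
    fix \<beta> :: "nat set" assume \<beta>: "finite \<beta>" "\<beta> \<subseteq> {n..}"
    have "finite \<alpha>" using that finite_subset by blast
    moreover have "\<alpha> \<subseteq> {m..}" "\<beta> \<subseteq> {m..}" using that \<beta> by fastforce+
    ultimately show "v (\<alpha> \<union> \<beta>) - v \<alpha> - v \<beta> = w (\<alpha> \<union> \<beta>) - w \<alpha> - w \<beta>"
      using Suc.prems(2) \<beta>(1) by simp
  qed
  then show ?case using Suc.prems by force
qed simp

text \<open>Shifting the argument keeps the degree and the leading coefficient, so the top terms
  cancel. The constant \<open>k\<close> reaches only coefficient 0, which lies below the degree of a
  non-constant \<open>p\<close>.\<close>

lemma degree_shift_diff_less:
  fixes p :: "'a::idom poly"
  assumes "degree p > 0"
  shows "degree (pcompose p [:c, 1:] - p - [:k:]) < degree p"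
proof (rule degree_lessI)
  have d: "degree (pcompose p [:c, 1:]) = degree p" by (simp add: degree_pcompose)
  have l: "coeff (pcompose p [:c, 1:]) (degree p) = coeff p (degree p)"
    using lead_coeff_comp[of "[:c, 1:]" p] d by simp
  show "\<forall>j\<ge>degree p. coeff (pcompose p [:c, 1:] - p - [:k:]) j = 0"
  proof (intro allI impI)
    fix j assume "j \<ge> degree p"
    then consider "j = degree p" | "j > degree p" by linarith
    then show "coeff (pcompose p [:c, 1:] - p - [:k:]) j = 0"
      by cases (use assms d l in \<open>auto simp: coeff_eq_0 coeff_pCons split: nat.split\<close>)
  qed
qed (use assms in simp)

text \<open>For \<open>\<beta>\<close> above \<open>\<alpha>\<close> the sums add, so a difference
  of the map is again a polynomial in the sum over \<open>\<beta>\<close>: a shift of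
  \<open>p\<close>, minus \<open>p\<close>, minus a constant. It vanishes at 0, and its degree is
  smaller unless \<open>p\<close> is constant, hence zero.\<close>

lemma set_poly_poly_sum:
  fixes p :: "int poly"
  assumes "poly p 0 = 0" "degree p \<le> d"
  shows "set_poly d m (\<lambda>\<beta>. poly p (\<Sum>t\<in>\<beta>. s t))"
  using assms
proof (induction d arbitrary: m p)
  case 0
  then obtain a where "p = [:a:]" using degree_eq_zeroE by blast
  with 0 show ?case by simp
next
  case (Suc d)
  have "set_poly d n (\<lambda>\<beta>. poly p (sum s (\<alpha> \<union> \<beta>)) - poly p (sum s \<alpha>) - poly p (sum s \<beta>))"
    if "n \<ge> m" "\<alpha> \<subseteq> {m..<n}" for n \<alpha>
  proof -
    define q where "q = pcompose p [:sum s \<alpha>, 1:] - p - [:poly p (sum s \<alpha>):]"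
    have "degree q \<le> d"
    proof (cases "degree p = 0")
      case True
      then obtain a where "p = [:a:]" using degree_eq_zeroE by blast
      then show ?thesis by (simp add: q_def)
    next
      case False
      then show ?thesis
        using degree_shift_diff_less[of p "sum s \<alpha>" "poly p (sum s \<alpha>)"] Suc.prems
        by (simp add: q_def)
    qed
    moreover have "poly q 0 = 0" using Suc.prems by (simp add: q_def poly_pcompose)
    ultimately have *: "set_poly d n (\<lambda>\<beta>. poly q (sum s \<beta>))" by (rule Suc.IH[rotated])
    have "finite \<alpha>" using that finite_subset by blast
    then have "poly p (sum s (\<alpha> \<union> \<beta>)) = poly p (sum s \<alpha> + sum s \<beta>)"
      if "finite \<beta>" "\<beta> \<subseteq> {n..}" for \<beta>
      using that \<open>\<alpha> \<subseteq> {m..<n}\<close> by (subst sum.union_disjoint) fastforce+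
    with * show ?thesis by (elim set_poly_cong) (simp add: q_def poly_pcompose)
  qed
  then show ?case using Suc.prems by simp
qed


declare set_poly.simps(2) [simp del]

section \<open>Partition regularity with uniform bounds\<close>

text \<open>The bounds \<open>N\<close> and \<open>W\<close> are chosen before the colouring.
  Focusing can therefore draw new directions from beyond \<open>N\<close>, and a thick set can
  receive all candidate points at once.\<close>

definition IP_regular :: "(nat set \<Rightarrow> int) set \<Rightarrow> nat \<Rightarrow> bool" where
  "IP_regular V m \<longleftrightarrow> (\<forall>r. \<exists>N W. finite W \<and> (\<forall>c :: int \<Rightarrow> nat. range c \<subseteq> {..<r} \<longrightarrow>
     (\<exists>a\<in>W. \<exists>\<beta>\<subseteq>{m..<N}. \<beta> \<noteq> {} \<and> (\<forall>v\<in>V. c (a + v \<beta>) = c a))))"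

lemma IP_regular_trivial:
  assumes "\<forall>v\<in>V. set_poly 0 m v"
  shows "IP_regular V m"
proof -
  have "\<forall>v\<in>V. v {m} = 0" using assms by simp
  then have "\<forall>v\<in>V. c (0 + v {m}) = c 0" for c :: "int \<Rightarrow> nat" by auto
  moreover have "{m} \<subseteq> {m..<Suc m}" by simp
  ultimately have "\<exists>a\<in>{0}. \<exists>\<beta>\<subseteq>{m..<Suc m}. \<beta> \<noteq> {} \<and> (\<forall>v\<in>V. c (a + v \<beta>) = c a)"
    for c :: "int \<Rightarrow> nat" by blast
  then show ?thesis unfolding IP_regular_def
    by (intro allI exI[of _ "Suc m"] exI[of _ "{0}"]) simp
qed

text \<open>Focusing creates zero maps, for instance from \<open>v = v\<^sub>1\<close> and
  \<open>\<alpha> = {}\<close>. They ask only for \<open>c a = c a\<close>, so the induction may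
  discard them.\<close>

lemma IP_regular_drop_zeros:
  assumes "IP_regular {v\<in>V. \<not> set_poly 0 m v} m"
  shows "IP_regular V m"
  unfolding IP_regular_def
proof
  fix r
  obtain N W where W: "finite W" and *: "\<forall>c :: int \<Rightarrow> nat. range c \<subseteq> {..<r} \<longrightarrow>
      (\<exists>a\<in>W. \<exists>\<beta>\<subseteq>{m..<N}. \<beta> \<noteq> {} \<and> (\<forall>v\<in>{v\<in>V. \<not> set_poly 0 m v}. c (a + v \<beta>) = c a))"
    using assms[unfolded IP_regular_def, THEN spec, of r] by (elim exE conjE) (rule that)
  have main: "\<exists>a\<in>W. \<exists>\<beta>\<subseteq>{m..<N}. \<beta> \<noteq> {} \<and> (\<forall>v\<in>V. c (a + v \<beta>) = c a)"
    if c: "range c \<subseteq> {..<r}" for c :: "int \<Rightarrow> nat"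
  proof -
    obtain a \<beta> where a: "a \<in> W" "\<beta> \<subseteq> {m..<N}" "\<beta> \<noteq> {}"
      and eq: "\<forall>v\<in>{v\<in>V. \<not> set_poly 0 m v}. c (a + v \<beta>) = c a"
      using *[rule_format, OF c] by blast
    have "finite \<beta>" "\<beta> \<subseteq> {m..}" using a(2) finite_subset by fastforce+
    then have zero: "v \<beta> = 0" if "set_poly 0 m v" for v using that by simp
    have "c (a + v \<beta>) = c a" if "v \<in> V" for v
      using eq that zero[of v] by (cases "set_poly 0 m v") (simp_all del: set_poly.simps)
    then show ?thesis using a by blast
  qed
  show "\<exists>N W. finite W \<and> (\<forall>c :: int \<Rightarrow> nat. range c \<subseteq> {..<r} \<longrightarrow>
     (\<exists>a\<in>W. \<exists>\<beta>\<subseteq>{m..<N}. \<beta> \<noteq> {} \<and> (\<forall>v\<in>V. c (a + v \<beta>) = c a)))"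
    by (intro exI[of _ N] exI[of _ W] conjI allI impI W main)
qed

section \<open>Colour focusing\<close>

text \<open>These maps are displacements: when the focus moves from \<open>f\<close> to
  \<open>f - v\<^sub>1 \<beta>\<close>, the point that \<open>v (\<alpha> \<union> \<beta>)\<close>
  reaches from the new focus is the old point \<open>f + v \<alpha>\<close> moved by the derived map
  at \<open>\<beta>\<close>.\<close>

definition focus_derived ::
  "(nat set \<Rightarrow> int) \<Rightarrow> nat set set \<Rightarrow> (nat set \<Rightarrow> int) set \<Rightarrow> (nat set \<Rightarrow> int) set" where
  "focus_derived v\<^sub>1 \<Lambda> V = (\<lambda>(v, \<alpha>) \<beta>. v (\<alpha> \<union> \<beta>) - v \<alpha> - v\<^sub>1 \<beta>) ` (V \<times> \<Lambda>)"

text \<open>Colouring an integer by the pattern seen in a finite window around it reduces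
  patterns to colours.\<close>

lemma IP_regular_window:
  assumes "IP_regular V m" "finite W"
  shows "\<exists>N Z. finite Z \<and> (\<forall>c :: int \<Rightarrow> nat. range c \<subseteq> {..<r} \<longrightarrow>
     (\<exists>a\<in>Z. \<exists>\<beta>\<subseteq>{m..<N}. \<beta> \<noteq> {} \<and> (\<forall>v\<in>V. \<forall>w\<in>W. c (a + w + v \<beta>) = c (a + w))))"
proof -
  \<comment> \<open>\<open>E\<close> contains every possible pattern on the window; numbering it by
    \<open>e\<close> turns patterns into colours of the required form.\<close>
  define E where "E = PiE W (\<lambda>_. {..<r})"
  have "finite E" using assms(2) by (auto simp: E_def intro: finite_PiE)
  then obtain e where e: "bij_betw e E {0..<card E}" using ex_bij_betw_finite_nat by blast
  obtain N Z where Z: "finite Z" and *: "\<forall>c :: int \<Rightarrow> nat. range c \<subseteq> {..<card E} \<longrightarrow>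
      (\<exists>a\<in>Z. \<exists>\<beta>\<subseteq>{m..<N}. \<beta> \<noteq> {} \<and> (\<forall>v\<in>V. c (a + v \<beta>) = c a))"
    using assms(1)[unfolded IP_regular_def, THEN spec, of "card E"] by (elim exE conjE) (rule that)
  have "\<exists>a\<in>Z. \<exists>\<beta>\<subseteq>{m..<N}. \<beta> \<noteq> {} \<and> (\<forall>v\<in>V. \<forall>w\<in>W. c (a + w + v \<beta>) = c (a + w))"
    if c: "range c \<subseteq> {..<r}" for c :: "int \<Rightarrow> nat"
  proof -
    define p where "p z = restrict (\<lambda>w. c (z + w)) W" for z
    have pE: "p z \<in> E" for z using c by (auto simp: p_def E_def)
    then have "range (e \<circ> p) \<subseteq> {..<card E}" using e by (auto simp: bij_betw_def)
    from *[rule_format, OF this] obtain a \<beta> where a: "a \<in> Z" "\<beta> \<subseteq> {m..<N}" "\<beta> \<noteq> {}"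
      and eq: "\<forall>v\<in>V. e (p (a + v \<beta>)) = e (p a)" by auto
    have "c (a + w + v \<beta>) = c (a + w)" if "v \<in> V" "w \<in> W" for v w
    proof -
      have "p (a + v \<beta>) = p a" using e eq pE that(1) by (meson bij_betw_def inj_onD)
      then have "p (a + v \<beta>) w = p a w" by simp
      then show ?thesis using that(2) by (simp add: p_def algebra_simps)
    qed
    then show ?thesis using a by blast
  qed
  then show ?thesis using Z by blast
qed

text \<open>As long as no monochromatic pattern appears, one more colour can be focused, and
  \<open>r + 1\<close> different colours do not exist. Regularity of the derived family keeps the
  colours of the old points while the focus moves.\<close>

lemma IP_regular_focus:
  assumes V: "finite V" "\<forall>v\<in>V. v {} = 0"
    and derived: "\<And>N \<Lambda>. N \<ge> m \<Longrightarrow> \<Lambda> \<subseteq> Pow {m..<N} \<Longrightarrow> IP_regular (focus_derived v\<^sub>1 \<Lambda> V) N"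
  shows "IP_regular V m"
  unfolding IP_regular_def
proof
  fix r
  define good where "good c W N \<longleftrightarrow>
    (\<exists>a\<in>W. \<exists>\<beta>\<subseteq>{m..<N}. \<beta> \<noteq> {} \<and> (\<forall>v\<in>V. c (a + v \<beta>) = c a))" for c :: "int \<Rightarrow> nat" and W N
  \<comment> \<open>The colour of \<open>f\<close> itself is left open: \<open>f\<close> is the
    common base of \<open>k\<close> patterns in different colours, each of which lacks only its base
    point.\<close>
  define focused where "focused k c f N \<longleftrightarrow> (\<exists>K\<subseteq>{..<r}. card K = k \<and>
    (\<forall>\<kappa>\<in>K. \<exists>\<beta>\<subseteq>{m..<N}. \<beta> \<noteq> {} \<and> (\<forall>v\<in>V. c (f + v \<beta>) = \<kappa>)))" for k and c :: "int \<Rightarrow> nat" and f N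
  have "\<exists>N\<ge>m. \<exists>W. finite W \<and> (\<forall>c. range c \<subseteq> {..<r} \<longrightarrow> good c W N \<or> (\<exists>f\<in>W. focused k c f N))" for k
  proof (induction k)
    case 0
    have "focused 0 c 0 m" for c unfolding focused_def by (rule exI[of _ "{}"]) simp
    then show ?case by (intro exI[of _ m] conjI exI[of _ "{0}"]) auto
  next
    case (Suc k)
    then obtain N W where N: "N \<ge> m" and W: "finite W"
      and step: "\<And>c. range c \<subseteq> {..<r} \<Longrightarrow> good c W N \<or> (\<exists>f\<in>W. focused k c f N)" by blast
    \<comment> \<open>The window holds every possible old focus and every point of an old pattern,
      since all of them must keep their colours.\<close>
    define W2 where "W2 = W \<union> (\<lambda>(f, v, \<alpha>). f + v \<alpha>) ` (W \<times> V \<times> Pow {m..<N})"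
    have "finite W2" using W V by (simp add: W2_def)
    moreover have "IP_regular (focus_derived v\<^sub>1 (Pow {m..<N}) V) N" using derived N by blast
    ultimately obtain N' Z where Z: "finite Z" and pat: "\<And>c :: int \<Rightarrow> nat. range c \<subseteq> {..<r} \<Longrightarrow>
       \<exists>a\<in>Z. \<exists>\<beta>\<subseteq>{N..<N'}. \<beta> \<noteq> {} \<and>
         (\<forall>v\<in>focus_derived v\<^sub>1 (Pow {m..<N}) V. \<forall>w\<in>W2. c (a + w + v \<beta>) = c (a + w))"
      using IP_regular_window[of _ N W2 r] by metis
    \<comment> \<open>Old directions lie below \<open>N\<close>, the new one below
      \<open>N'\<close>; the maximum bounds both.\<close>
    define M where "M = max N N'"
    \<comment> \<open>The first part serves as base points of monochromatic patterns, the second as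
      new foci.\<close>
    define W' where "W' = (\<lambda>(z, f). z + f) ` (Z \<times> W) \<union>
      (\<lambda>(z, f, \<beta>). z + f - v\<^sub>1 \<beta>) ` (Z \<times> W \<times> Pow {N..<N'})"
    have "finite W'" using W Z by (simp add: W'_def)
    moreover have "good c W' M \<or> (\<exists>f\<in>W'. focused (Suc k) c f M)" if c: "range c \<subseteq> {..<r}" for c
    proof -
      obtain z \<beta>\<^sub>0 where z: "z \<in> Z" and \<beta>\<^sub>0: "\<beta>\<^sub>0 \<subseteq> {N..<N'}" "\<beta>\<^sub>0 \<noteq> {}"
        and same: "\<And>u w. u \<in> focus_derived v\<^sub>1 (Pow {m..<N}) V \<Longrightarrow> w \<in> W2 \<Longrightarrow>
          c (z + w + u \<beta>\<^sub>0) = c (z + w)" using pat[OF c] by blast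
      have same': "c (z + w + (v (\<alpha> \<union> \<beta>\<^sub>0) - v \<alpha> - v\<^sub>1 \<beta>\<^sub>0)) = c (z + w)"
        if "v \<in> V" "\<alpha> \<subseteq> {m..<N}" "w \<in> W2" for v \<alpha> w
      proof -
        have "(\<lambda>\<beta>. v (\<alpha> \<union> \<beta>) - v \<alpha> - v\<^sub>1 \<beta>) \<in> focus_derived v\<^sub>1 (Pow {m..<N}) V"
          using that by (force simp: focus_derived_def)
        from same[OF this that(3)] show ?thesis .
      qed
      have sub: "\<beta> \<subseteq> {m..<M}" if "\<beta> \<subseteq> {m..<N}" for \<beta> using that by (fastforce simp: M_def)
      \<comment> \<open>The induction hypothesis is applied to the colouring seen from
        \<open>z\<close>, around which derived moves leave colours on the window unchanged.\<close>
      have "range (\<lambda>y. c (z + y)) \<subseteq> {..<r}" using c by auto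
      from step[OF this] show ?thesis
      proof
        assume "good (\<lambda>y. c (z + y)) W N"
        then obtain a \<beta> where a: "a \<in> W" "\<beta> \<subseteq> {m..<N}" "\<beta> \<noteq> {}"
          "\<forall>v\<in>V. c (z + a + v \<beta>) = c (z + a)" unfolding good_def by (auto simp: add.assoc)
        moreover from a(1) have "z + a \<in> W'" using z a(1) by (auto simp: W'_def)
        ultimately have "good c W' M" unfolding good_def using sub[OF a(2)]
          by (intro bexI[of _ "z + a"] exI[of _ \<beta>]) simp_all
        then show ?thesis ..
      next
        assume "\<exists>f\<in>W. focused k (\<lambda>y. c (z + y)) f N"
        then obtain f K where f: "f \<in> W" and K: "K \<subseteq> {..<r}" "card K = k"
          and foc: "\<And>\<kappa>. \<kappa> \<in> K \<Longrightarrow> \<exists>\<beta>\<subseteq>{m..<N}. \<beta> \<noteq> {} \<and> (\<forall>v\<in>V. c (z + (f + v \<beta>)) = \<kappa>)"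
          unfolding focused_def by blast
        \<comment> \<open>An old focus whose colour is already focused completes the pattern of that
          colour; otherwise its colour is the additional one.\<close>
        show ?thesis
        proof (cases "c (z + f) \<in> K")
          case True
          from foc[OF this] obtain \<beta> where \<beta>: "\<beta> \<subseteq> {m..<N}" "\<beta> \<noteq> {}"
            "\<forall>v\<in>V. c (z + f + v \<beta>) = c (z + f)" by (auto simp: add.assoc)
          moreover have "z + f \<in> W'" using z f by (auto simp: W'_def)
          ultimately have "good c W' M" unfolding good_def using sub[OF \<beta>(1)]
            by (intro bexI[of _ "z + f"] exI[of _ \<beta>]) simp_all
          then show ?thesis ..
        next
          case False
          text \<open>The new focus is chosen so that \<open>f' + v\<^sub>1 \<beta>\<^sub>0\<close> is the old one; prolonging every
            old \<open>\<beta>\<close> by \<open>\<beta>\<^sub>0\<close> keeps its colour, and \<open>\<beta>\<^sub>0\<close> alone contributes the old focus' colour.\<close>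
          define f' where "f' = z + f - v\<^sub>1 \<beta>\<^sub>0"
          define K' where "K' = insert (c (z + f)) K"
          have "f' \<in> W'" using z f \<beta>\<^sub>0 by (force simp: W'_def f'_def)
          moreover have "K' \<subseteq> {..<r}" using K c by (auto simp: K'_def)
          moreover have "card K' = Suc k"
            using K False finite_subset[OF K(1)] by (simp add: K'_def)
          moreover have "\<exists>\<beta>\<subseteq>{m..<M}. \<beta> \<noteq> {} \<and> (\<forall>v\<in>V. c (f' + v \<beta>) = \<kappa>)" if "\<kappa> \<in> K'" for \<kappa>
          proof -
            have \<beta>\<^sub>0M: "\<beta>\<^sub>0 \<subseteq> {m..<M}" using \<beta>\<^sub>0 N by (fastforce simp: M_def)
            from \<open>\<kappa> \<in> K'\<close> consider "\<kappa> = c (z + f)" | "\<kappa> \<in> K" by (auto simp: K'_def)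
            then show ?thesis
            proof cases
              case 1
              \<comment> \<open>With \<open>\<alpha> = {}\<close> and \<open>v {} = 0\<close> the
                displaced old point is the old focus itself.\<close>
              have "c (f' + v \<beta>\<^sub>0) = \<kappa>" if "v \<in> V" for v
                using same'[of v "{}" f] that bspec[OF V(2) that] f 1 by (simp add: W2_def f'_def algebra_simps)
              then show ?thesis using \<beta>\<^sub>0 \<beta>\<^sub>0M by blast
            next
              case 2
              from foc[OF this] obtain \<beta> where \<beta>: "\<beta> \<subseteq> {m..<N}"
                "\<forall>v\<in>V. c (z + (f + v \<beta>)) = \<kappa>" by blast
              have "c (f' + v (\<beta> \<union> \<beta>\<^sub>0)) = \<kappa>" if "v \<in> V" for v
              proof -
                have "f + v \<beta> \<in> W2" using f that \<beta> by (force simp: W2_def)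
                from same'[OF that \<beta>(1) this] show ?thesis
                  using \<beta>(2) that by (simp add: f'_def algebra_simps)
              qed
              then show ?thesis using sub[OF \<beta>(1)] \<beta>\<^sub>0 \<beta>\<^sub>0M
                by (intro exI[of _ "\<beta> \<union> \<beta>\<^sub>0"]) auto
            qed
          qed
          ultimately have "focused (Suc k) c f' M" unfolding focused_def by blast
          then show ?thesis using \<open>f' \<in> W'\<close> by blast
        qed
      qed
    qed
    moreover have "M \<ge> m" using N by (simp add: M_def)
    ultimately show ?case by blast
  qed
  from this[of "Suc r"] obtain N W where W: "finite W"
    and *: "\<And>c. range c \<subseteq> {..<r} \<Longrightarrow> good c W N \<or> (\<exists>f\<in>W. focused (Suc r) c f N)" by blast
  have "\<not> focused (Suc r) c f N" for c f
  proof
    assume "focused (Suc r) c f N"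
    then obtain K where "K \<subseteq> {..<r}" "card K = Suc r" unfolding focused_def by blast
    then show False using card_mono[of "{..<r}" K] by simp
  qed
  then show "\<exists>N W. finite W \<and> (\<forall>c :: int \<Rightarrow> nat. range c \<subseteq> {..<r} \<longrightarrow>
     (\<exists>a\<in>W. \<exists>\<beta>\<subseteq>{m..<N}. \<beta> \<noteq> {} \<and> (\<forall>v\<in>V. c (a + v \<beta>) = c a)))"
    using W * unfolding good_def by (intro exI[of _ N] exI[of _ W]) simp
qed

section \<open>PET induction on coset covers\<close>

text \<open>Zero maps are exempt because a coset with \<open>d = 0\<close> is a single map up to
  irrelevant values: subtracting that map leaves zero, and no smaller \<open>d\<close> exists to
  cover it.\<close>

definition coset_cover ::
  "(nat \<times> (nat set \<Rightarrow> int)) multiset \<Rightarrow> nat \<Rightarrow> (nat set \<Rightarrow> int) set \<Rightarrow> bool" where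
  "coset_cover C m V \<longleftrightarrow> (\<forall>(d, s)\<in>#C. set_poly (Suc d) m s) \<and>
     (\<forall>v\<in>V. set_poly 0 m v \<or> (\<exists>(d, s)\<in>#C. set_poly d m (\<lambda>\<beta>. v \<beta> - s \<beta>)))"

text \<open>A map \<open>v\<close> in the coset of \<open>(d, s)\<close> has degree at most
  \<open>Suc d\<close>, so its difference costs only degree \<open>d\<close> and the derived map
  stays in the coset of \<open>s - v\<^sub>1\<close>. Minimality of \<open>d\<^sub>1\<close> bounds
  the degree of this representative by \<open>Suc d\<close>. In the coset of
  \<open>v\<^sub>1\<close> itself the derived maps drop to degree \<open>d\<^sub>1\<close>.\<close>

lemma coset_cover_focus_derived:
  assumes cover: "coset_cover (add_mset (d\<^sub>1, s\<^sub>1) C) m V"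
    and min: "\<forall>(d, s)\<in>#C. d\<^sub>1 \<le> d"
    and v\<^sub>1: "set_poly d\<^sub>1 m (\<lambda>\<beta>. v\<^sub>1 \<beta> - s\<^sub>1 \<beta>)"
    and nz: "\<forall>v\<in>V. \<not> set_poly 0 m v"
    and fin: "finite V" and N: "m \<le> N" and \<Lambda>: "\<Lambda> \<subseteq> Pow {m..<N}"
  shows "\<exists>K. (\<forall>(d, s)\<in>#K. d < d\<^sub>1) \<and>
    coset_cover (image_mset (\<lambda>(d, s). (d, \<lambda>\<beta>. s \<beta> - v\<^sub>1 \<beta>)) C + K) N (focus_derived v\<^sub>1 \<Lambda> V)"
proof -
  let ?V' = "focus_derived v\<^sub>1 \<Lambda> V"
  let ?C' = "image_mset (\<lambda>(d, s). (d, \<lambda>\<beta>. s \<beta> - v\<^sub>1 \<beta>)) C"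
  define U where "U = {u \<in> ?V'. set_poly d\<^sub>1 N u}"
  \<comment> \<open>Each derived map of degree at most \<open>d\<^sub>1\<close> represents its own
    coset with number \<open>d\<^sub>1 - 1\<close>. For \<open>d\<^sub>1 = 0\<close> such maps are
    zero and exempt.\<close>
  define K where "K = (if d\<^sub>1 = 0 then {#} else mset_set ((\<lambda>u. (d\<^sub>1 - 1, u)) ` U))"
  have "finite \<Lambda>" using \<Lambda> finite_subset by blast
  then have finU: "finite U" using fin by (simp add: U_def focus_derived_def)
  have s: "set_poly (Suc d) m s" if "(d, s) \<in># add_mset (d\<^sub>1, s\<^sub>1) C" for d s
    using cover that unfolding coset_cover_def by blast
  have lift: "set_poly (Suc d) m v"
    if "set_poly d m (\<lambda>\<beta>. v \<beta> - s \<beta>)" "(d, s) \<in># add_mset (d\<^sub>1, s\<^sub>1) C" for d v s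
    using set_poly_add[OF set_poly_Suc[OF that(1)] s[OF that(2)]] by simp
  have v\<^sub>1_deg: "set_poly (Suc d) N v\<^sub>1" if "(d, s) \<in># C" for d s
    using set_poly_mono_start[OF set_poly_mono_degree[OF lift[OF v\<^sub>1]] N] bspec[OF min that] by simp
  have "set_poly (Suc d) N s" if ds: "(d, s) \<in># ?C' + K" for d s
  proof -
    from ds have "(d, s) \<in># ?C' \<or> (d, s) \<in># K" by simp
    then show ?thesis
    proof
      assume "(d, s) \<in># ?C'"
      then obtain s' where "(d, s') \<in># C" "s = (\<lambda>\<beta>. s' \<beta> - v\<^sub>1 \<beta>)" by auto
      moreover from this have "set_poly (Suc d) N s'"
        using set_poly_mono_start[OF s N] by auto
      ultimately show ?thesis using set_poly_diff v\<^sub>1_deg by simp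
    next
      assume "(d, s) \<in># K"
      then have "Suc d = d\<^sub>1" "set_poly d\<^sub>1 N s"
        using finU by (auto simp: K_def U_def split: if_splits)
      then show ?thesis by simp
    qed
  qed
  moreover have "set_poly 0 N u \<or> (\<exists>(d, s)\<in>#?C' + K. set_poly d N (\<lambda>\<beta>. u \<beta> - s \<beta>))"
    if u: "u \<in> ?V'" for u
  proof -
    obtain v \<alpha> where v: "v \<in> V" and \<alpha>: "\<alpha> \<in> \<Lambda>" and ueq: "u = (\<lambda>\<beta>. v (\<alpha> \<union> \<beta>) - v \<alpha> - v\<^sub>1 \<beta>)"
      using u unfolding focus_derived_def by auto
    obtain d s where ds: "(d, s) \<in># add_mset (d\<^sub>1, s\<^sub>1) C" and vs: "set_poly d m (\<lambda>\<beta>. v \<beta> - s \<beta>)"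
      using cover v nz unfolding coset_cover_def by blast
    have "set_poly d N (\<lambda>\<beta>. v (\<alpha> \<union> \<beta>) - v \<alpha> - v \<beta>)"
      using lift[OF vs ds] \<alpha> \<Lambda> N by (auto simp: set_poly.simps(2))
    from set_poly_add[OF this set_poly_mono_start[OF vs N]]
    have us: "set_poly d N (\<lambda>\<beta>. v (\<alpha> \<union> \<beta>) - v \<alpha> - s \<beta>)" by (simp add: algebra_simps)
    from ds have "(d, s) \<in># C \<or> d = d\<^sub>1 \<and> s = s\<^sub>1" by auto
    then show ?thesis
    proof
      assume "(d, s) \<in># C"
      then have "(d, \<lambda>\<beta>. s \<beta> - v\<^sub>1 \<beta>) \<in># ?C' + K" by force
      moreover have "set_poly d N (\<lambda>\<beta>. u \<beta> - (s \<beta> - v\<^sub>1 \<beta>))" using us by (simp add: ueq algebra_simps)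
      ultimately show ?thesis by (intro disjI2 bexI[of _ "(d, \<lambda>\<beta>. s \<beta> - v\<^sub>1 \<beta>)"]) simp_all
    next
      assume "d = d\<^sub>1 \<and> s = s\<^sub>1"
      then have ud: "set_poly d\<^sub>1 N u"
        using set_poly_diff[OF us, of "\<lambda>\<beta>. v\<^sub>1 \<beta> - s\<^sub>1 \<beta>"] set_poly_mono_start[OF v\<^sub>1 N]
        by (simp add: ueq algebra_simps)
      show ?thesis
      proof (cases "d\<^sub>1 = 0")
        case True
        then show ?thesis using ud by simp
      next
        case False
        then have "(d\<^sub>1 - 1, u) \<in># ?C' + K" using ud u finU by (auto simp: K_def U_def)
        moreover have "set_poly (d\<^sub>1 - 1) N (\<lambda>\<beta>. u \<beta> - u \<beta>)" by (simp add: set_poly_zero)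
        ultimately show ?thesis by (intro disjI2 bexI[of _ "(d\<^sub>1 - 1, u)"]) simp_all
      qed
    qed
  qed
  moreover have "\<forall>(d, s)\<in>#K. d < d\<^sub>1" using finU by (auto simp: K_def)
  ultimately show ?thesis unfolding coset_cover_def by (intro exI[of _ K]) blast
qed

text \<open>The one-step multiset order suffices for the induction, since each round alters a single
  entry of the multiset of numbers \<open>d\<close>. The start \<open>m\<close> is generalised
  because derived families begin at a later \<open>N\<close>.\<close>

lemma IP_regular_coset_cover:
  assumes "finite V" "coset_cover C m V"
  shows "IP_regular V m"
proof -
  have "\<forall>C m V. image_mset fst C = D \<longrightarrow> finite V \<longrightarrow> coset_cover C m V \<longrightarrow> IP_regular V m" for D
  proof (induction D rule: wf_induct_rule[OF wf_mult1[OF wf_less_than]])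
    case (1 D)
    have IH: "IP_regular V m"
      if "(image_mset fst C, D) \<in> mult1 less_than" "finite V" "coset_cover C m V" for C m V
      using 1 that by blast
    show ?case
    proof (intro allI impI)
      fix C m V
      assume D: "image_mset fst C = D" and fin: "finite V" and cover: "coset_cover C m V"
      define V0 where "V0 = {v\<in>V. \<not> set_poly 0 m v}"
      have fin0: "finite V0" and nz: "\<forall>v\<in>V0. \<not> set_poly 0 m v" using fin by (auto simp: V0_def)
      have cover0: "coset_cover C m V0" using cover by (auto simp: coset_cover_def V0_def)
      have "IP_regular V0 m"
      proof (cases "C = {#}")
        case True
        then show ?thesis using cover0 by (intro IP_regular_trivial) (auto simp: coset_cover_def)
      next
        case False
        then obtain c where c: "c \<in># C" "\<And>c'. c' \<in># C \<Longrightarrow> fst c \<le> fst c'"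
          using ex_min_if_finite[of "fst ` set_mset C"] by (auto simp: not_less)
        obtain d\<^sub>1 s\<^sub>1 where c_eq: "c = (d\<^sub>1, s\<^sub>1)" by force
        define B where "B = C - {#c#}"
        have C: "C = add_mset (d\<^sub>1, s\<^sub>1) B" using c(1) by (simp add: B_def c_eq)
        have min: "\<forall>(d, s)\<in>#B. d\<^sub>1 \<le> d" using c(2) C c_eq by fastforce
        \<comment> \<open>One copy of \<open>d\<^sub>1\<close> is exchanged for finitely many
          smaller numbers.\<close>
        have less: "(image_mset fst B + K, D) \<in> mult1 less_than" if "\<forall>d\<in>#K. d < d\<^sub>1" for K
          using that D C by (auto simp: mult1_def)
        show ?thesis
        proof (cases "\<exists>v\<^sub>1\<in>V0. set_poly d\<^sub>1 m (\<lambda>\<beta>. v\<^sub>1 \<beta> - s\<^sub>1 \<beta>)")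
          case False
          \<comment> \<open>A coset without members is simply removed, the case of an empty
            replacement.\<close>
          then have "coset_cover B m V0" using cover0 unfolding C coset_cover_def by auto
          then show ?thesis using IH[of B V0 m] less[of "{#}"] fin0 by simp
        next
          case True
          then obtain v\<^sub>1 where v\<^sub>1: "set_poly d\<^sub>1 m (\<lambda>\<beta>. v\<^sub>1 \<beta> - s\<^sub>1 \<beta>)" by blast
          show ?thesis
          proof (rule IP_regular_focus[OF fin0])
            show "\<forall>v\<in>V0. v {} = 0"
            proof
              fix v assume "v \<in> V0"
              then obtain d s where "(d, s) \<in># C" "set_poly d m (\<lambda>\<beta>. v \<beta> - s \<beta>)"
                using cover0 nz unfolding coset_cover_def by blast
              moreover from this have "set_poly (Suc d) m s" using cover0 unfolding coset_cover_def by blast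
              ultimately show "v {} = 0"
                using set_poly_empty[of d m "\<lambda>\<beta>. v \<beta> - s \<beta>"] set_poly_empty[of "Suc d" m s] by simp
            qed
            fix N \<Lambda> assume N: "m \<le> N" and \<Lambda>: "\<Lambda> \<subseteq> Pow {m..<N}"
            obtain K where K: "\<forall>(d, s)\<in>#K. d < d\<^sub>1" and cover':
              "coset_cover (image_mset (\<lambda>(d, s). (d, \<lambda>\<beta>. s \<beta> - v\<^sub>1 \<beta>)) B + K) N (focus_derived v\<^sub>1 \<Lambda> V0)"
              using coset_cover_focus_derived[OF cover0[unfolded C] min v\<^sub>1 nz fin0 N \<Lambda>] by (elim exE conjE) (rule that)
            have "image_mset fst (image_mset (\<lambda>(d, s). (d, \<lambda>\<beta>. s \<beta> - v\<^sub>1 \<beta>)) B + K)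
                = image_mset fst B + image_mset fst K"
              by (simp add: multiset.map_comp comp_def case_prod_beta)
            moreover have "finite (focus_derived v\<^sub>1 \<Lambda> V0)"
              using fin0 \<Lambda> finite_subset[OF \<Lambda>] by (simp add: focus_derived_def)
            moreover have "\<forall>d\<in>#image_mset fst K. d < d\<^sub>1" using K by fastforce
            ultimately show "IP_regular (focus_derived v\<^sub>1 \<Lambda> V0) N"
              using less by (intro IH[OF _ _ cover']) simp_all
          qed
        qed
      qed
      then show "IP_regular V m" unfolding V0_def by (rule IP_regular_drop_zeros)
    qed
  qed
  then show ?thesis using assms by blast
qed

text \<open>Every map of degree at most \<open>d\<close> represents its own coset, being also of
  degree at most \<open>Suc d\<close>.\<close>

lemma IP_regular_set_poly:
  assumes "finite V" "\<And>v. v \<in> V \<Longrightarrow> \<exists>d. set_poly d m v"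
  shows "IP_regular V m"
proof -
  obtain d where d: "\<And>v. v \<in> V \<Longrightarrow> set_poly (d v) m v" using assms(2) by metis
  have "coset_cover (mset_set ((\<lambda>v. (d v, v)) ` V)) m V"
    using assms(1) d set_poly_Suc set_poly_zero unfolding coset_cover_def
    by fastforce
  then show ?thesis using IP_regular_coset_cover[OF assms(1)] by blast
qed

section \<open>Transfer to piecewise syndetic sets\<close>

text \<open>A pattern monochromatic for the colouring by translates lies, after a shift, in one
  translate of \<open>A\<close>; adding the element of \<open>G\<close> in question moves it into
  \<open>A\<close>.\<close>

lemma piecewise_syndetic_IP_regular:
  assumes A: "piecewise_syndetic A" and V: "finite V" "IP_regular V m"
  shows "\<exists>a\<in>Pos. \<exists>\<beta>. finite \<beta> \<and> \<beta> \<noteq> {} \<and> \<beta> \<subseteq> {m..} \<and> (\<forall>v\<in>V. int a + v \<beta> \<in> int ` A)"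
proof -
  obtain G where G: "finite G" "G \<noteq> {}" and th: "thick (\<Union>t\<in>G. {n \<in> Pos. t + n \<in> A})"
    using A unfolding piecewise_syndetic_def by blast
  obtain e where e: "bij_betw e G {0..<card G}" using ex_bij_betw_finite_nat[OF G(1)] by blast
  obtain N W where W: "finite W" and reg: "\<forall>c :: int \<Rightarrow> nat. range c \<subseteq> {..<card G} \<longrightarrow>
      (\<exists>a\<in>W. \<exists>\<beta>\<subseteq>{m..<N}. \<beta> \<noteq> {} \<and> (\<forall>v\<in>V. c (a + v \<beta>) = c a))"
    using V(2)[unfolded IP_regular_def, THEN spec, of "card G"] by (elim exE conjE) (rule that)
  \<comment> \<open>All points that any candidate pattern can use; 0 is inserted so that
    \<open>Min S\<close> makes sense.\<close>
  define S where "S = insert 0 (W \<union> (\<lambda>(a, v, \<beta>). a + v \<beta>) ` (W \<times> V \<times> Pow {m..<N}))"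
  have "finite S" using W V by (simp add: S_def)
  \<comment> \<open>The shift by \<open>b\<close> moves the least element of \<open>S\<close> to 1,
    as thickness concerns positive integers only.\<close>
  define b where "b = 1 - Min S"
  have pos: "z + b \<ge> 1" if "z \<in> S" for z using \<open>finite S\<close> that by (simp add: b_def)
  define H where "H = (\<lambda>z. nat (z + b)) ` S"
  have "finite H" "H \<noteq> {}" using \<open>finite S\<close> by (simp_all add: H_def S_def)
  moreover have "H \<subseteq> Pos" using pos by (fastforce simp: H_def)
  ultimately obtain x where x: "\<And>h. h \<in> H \<Longrightarrow> h + x \<in> (\<Union>t\<in>G. {n \<in> Pos. t + n \<in> A})"
    using th unfolding thick_def by meson
  \<comment> \<open>The colouring must be total, so outside \<open>S\<close> an arbitrary element of
    \<open>G\<close> is allowed.\<close>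
  have "\<exists>t. t \<in> G \<and> (z \<in> S \<longrightarrow> t + (nat (z + b) + x) \<in> A)" for z
  proof (cases "z \<in> S")
    case True
    then show ?thesis using x[of "nat (z + b)"] by (auto simp: H_def)
  qed (use G in auto)
  then obtain t where t: "\<And>z. t z \<in> G" "\<And>z. z \<in> S \<Longrightarrow> t z + (nat (z + b) + x) \<in> A" by metis
  have "range (e \<circ> t) \<subseteq> {..<card G}" using e t(1) by (auto simp: bij_betw_def)
  from reg[rule_format, OF this] obtain a \<beta> where a: "a \<in> W" and \<beta>: "\<beta> \<subseteq> {m..<N}" "\<beta> \<noteq> {}"
    and mono: "\<And>v. v \<in> V \<Longrightarrow> e (t (a + v \<beta>)) = e (t a)" by auto
  define k where "k = t a + (nat (a + b) + x)"
  have aS: "a \<in> S" using a by (simp add: S_def)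
  have "int k + v \<beta> \<in> int ` A" if "v \<in> V" for v
  proof -
    have "(a, v, \<beta>) \<in> W \<times> V \<times> Pow {m..<N}" using a that \<beta> by simp
    from imageI[OF this, of "\<lambda>(a, v, \<beta>). a + v \<beta>"] have S: "a + v \<beta> \<in> S" by (simp add: S_def)
    have "t (a + v \<beta>) = t a" using mono[OF that] e t(1) by (meson bij_betw_def inj_onD)
    then have "t a + (nat (a + v \<beta> + b) + x) \<in> A" using t(2)[OF S] by simp
    moreover have "int k + v \<beta> = int (t a + (nat (a + v \<beta> + b) + x))"
      using pos[OF S] pos[OF aS] by (simp add: k_def)
    ultimately show ?thesis by blast
  qed
  moreover have "k \<in> Pos" using pos[OF aS] by (simp add: k_def)
  moreover have "finite \<beta>" "\<beta> \<subseteq> {m..}" using \<beta> finite_subset by fastforce+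
  ultimately show ?thesis using \<beta>(2) by blast
qed

theorem theorem2p2:
  fixes l :: nat
    and A :: "nat set"
    and x :: "nat \<Rightarrow> nat set \<Rightarrow> nat"
    and F :: "int poly set"
  assumes "l \<in> Pos"
    and "A \<subseteq> Pos"
    and "piecewise_syndetic A"
    and "\<And>i. i \<in> {1..l} \<Longrightarrow> IP_set (x i)"
    and "finite F"
    and "F \<subseteq> IPoly"
  shows "\<exists>a\<in>Pos. \<exists>\<beta>. finite \<beta> \<and> \<beta> \<noteq> {} \<and> \<beta> \<subseteq> Pos \<and>
           (\<forall>i\<in>{1..l}. \<forall>P\<in>F. int a + poly P (int (x i \<beta>)) \<in> int ` A)"
proof -
  have "\<forall>i\<in>{1..l}. \<exists>s. \<forall>\<alpha>. finite \<alpha> \<and> \<alpha> \<noteq> {} \<and> \<alpha> \<subseteq> Pos \<longrightarrow> x i \<alpha> = (\<Sum>t\<in>\<alpha>. s t)"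
    using assms(4) unfolding IP_set_def by blast
  then obtain s where s: "\<And>i \<alpha>. i \<in> {1..l} \<Longrightarrow> finite \<alpha> \<Longrightarrow> \<alpha> \<noteq> {} \<Longrightarrow> \<alpha> \<subseteq> Pos \<Longrightarrow>
      x i \<alpha> = (\<Sum>t\<in>\<alpha>. s i t)" by metis
  \<comment> \<open>The sums replace \<open>x i\<close>, whose value at the empty set is arbitrary,
    whereas polynomial maps must vanish there.\<close>
  define v where "v = (\<lambda>(i, P) \<beta>. poly P (\<Sum>t\<in>\<beta>. int (s i t)))"
  have "\<exists>d. set_poly d 1 u" if "u \<in> v ` ({1..l} \<times> F)" for u
    using that assms(6) set_poly_poly_sum by (fastforce simp: v_def IPoly_def)
  then have "IP_regular (v ` ({1..l} \<times> F)) 1" using assms(5) by (intro IP_regular_set_poly) auto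
  then obtain a \<beta> where a: "a \<in> Pos" and \<beta>: "finite \<beta>" "\<beta> \<noteq> {}" "\<beta> \<subseteq> Pos"
    and A: "\<forall>u\<in>v ` ({1..l} \<times> F). int a + u \<beta> \<in> int ` A"
    using piecewise_syndetic_IP_regular[OF assms(3), of "v ` ({1..l} \<times> F)" 1] assms(5) by auto
  have "int a + poly P (int (x i \<beta>)) \<in> int ` A" if "i \<in> {1..l}" "P \<in> F" for i P
  proof -
    have "int a + v (i, P) \<beta> \<in> int ` A" using A that by blast
    then show ?thesis using s[OF that(1) \<beta>] by (simp add: v_def)
  qed
  then show ?thesis using a \<beta> by blast
qed

end
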